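(* Let $n=pq$, where $p$ is a prime and $q$ is a positive integer. If $\gcd(p,q)=1$, then the domination number of the discrete torus $T_n$ satisfies $D_n^T\le 2p$; otherwise, $D_n^T\le 2(p+1)$.
   Context: The discrete $n\times n$ torus is $T_n=\{0,1,\dots,n-1\}\times\{0,1,\dots,n-1\}$, and $\pi_n:\mathbb Z\times\mathbb Z\to T_n$ is $\pi_n(x_1,x_2)=(x_1 \bmod n,\ x_2\bmod n)$, where $a \bmod b$ is the smallest non-negative remainder. A line in $\mathbb Z\times\mathbb Z$ is the intersection with $\mathbb Z\times\mathbb Z$ of a straight line in the plane through at least two integer points. A line on the torus $T_n$ is the image under $\pi_n$ of a line in $\mathbb Z\times\mathbb Z$. A set of points of $T_n$ is collinear if it is contained in a line on the torus. A point $p\in T_n$ is dominated by $S\subseteq T_n$ if $p\in S$ or there exist two distinct points $x,y\in S$ such that $\{x,y,p\}$ is collinear on the torus. $S$ is a dominating set of $T_n$ if every point of $T_n$ is dominated by $S$. The domination number $D_n^T$ is the smallest size of a dominating set of $T_n$. *)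

theory Defs
  imports "HOL-Analysis.Analysis" "HOL-Computational_Algebra.Primes"
begin

definition torus :: "nat \<Rightarrow> (int \<times> int) set" where
  "torus n = {0..<int n} \<times> {0..<int n}"

definition torus_proj :: "nat \<Rightarrow> int \<times> int \<Rightarrow> int \<times> int" where
  "torus_proj n x = (fst x mod int n, snd x mod int n)"

definition to_plane :: "int \<times> int \<Rightarrow> real \<times> real" where
  "to_plane x = (real_of_int (fst x), real_of_int (snd x))"

definition plane_line :: "(real \<times> real) set \<Rightarrow> bool" where
  "plane_line P \<longleftrightarrow> affine P \<and> aff_dim P = 1"

definition lattice_line :: "(int \<times> int) set \<Rightarrow> bool" where
  "lattice_line L \<longleftrightarrow>
     (\<exists>P. plane_line P
        \<and> (\<exists>a b. a \<noteq> b \<and> to_plane a \<in> P \<and> to_plane b \<in> P)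
        \<and> L = {x. to_plane x \<in> P})"

definition torus_line :: "nat \<Rightarrow> (int \<times> int) set \<Rightarrow> bool" where
  "torus_line n M \<longleftrightarrow> (\<exists>L. lattice_line L \<and> M = torus_proj n ` L)"

definition torus_collinear :: "nat \<Rightarrow> (int \<times> int) set \<Rightarrow> bool" where
  "torus_collinear n A \<longleftrightarrow> (\<exists>M. torus_line n M \<and> A \<subseteq> M)"

definition dominated :: "nat \<Rightarrow> (int \<times> int) set \<Rightarrow> int \<times> int \<Rightarrow> bool" where
  "dominated n S z \<longleftrightarrow>
     z \<in> S \<or> (\<exists>x\<in>S. \<exists>y\<in>S. x \<noteq> y \<and> torus_collinear n {x, y, z})"

definition dominating_set :: "nat \<Rightarrow> (int \<times> int) set \<Rightarrow> bool" where
  "dominating_set n S \<longleftrightarrow> S \<subseteq> torus n \<and> (\<forall>z\<in>torus n. dominated n S z)"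

(* The minimum is attained: the torus is finite and dominates itself. *)
definition torus_domination_number :: "nat \<Rightarrow> nat" where
  "torus_domination_number n = (LEAST k. \<exists>S. dominating_set n S \<and> card S = k)"

end

theory Submission
  imports Defs "HOL-Number_Theory.Cong"
begin

text \<open>
  Already \<open>p + 2\<close> points suffice, and \<open>p + 2 \<le> 2 * p\<close>: take the origin together with the
  multiples \<open>q d\<close> of one representative \<open>d\<close> of each of the \<open>p + 1\<close> directions modulo \<open>p\<close>,
  namely \<open>(1, j)\<close> for \<open>0 \<le> j < p\<close> and \<open>(0, 1)\<close>. A point \<open>z \<noteq> (0, 0)\<close> is a multiple of a
  primitive integer vector \<open>w\<close>. Since \<open>w\<close> does not vanish modulo \<open>p\<close>, some multiple \<open>\<mu> w\<close> is
  congruent to a representative \<open>d\<close> modulo \<open>p\<close>, so that \<open>\<mu> q w\<close> is congruent to \<open>q d\<close> modulo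
  \<open>p q\<close>. Hence the line through the origin in direction \<open>w\<close> projects onto a line of the torus
  that contains the origin, \<open>q d\<close> and \<open>z\<close>.
\<close>

text \<open>Every integer multiple of \<open>(a, b)\<close> is an affine combination of the origin
  and \<open>(a, b)\<close>, hence on the real line through both. All lines used below pass through
  the origin.\<close>

lemma torus_collinear_multiples:
  fixes a b :: int
  assumes "(a, b) \<noteq> (0, 0)"
    and "\<And>x. x \<in> A \<Longrightarrow> \<exists>k. x = torus_proj n (k * a, k * b)"
  shows "torus_collinear n A"
proof -
  define P where "P = affine hull {0, to_plane (a, b)}"
  define L where "L = {x. to_plane x \<in> P}"
  have ne: "to_plane (a, b) \<noteq> 0"
    using assms(1) by (auto simp: to_plane_def zero_prod_def)
  have mult: "to_plane (k * a, k * b) \<in> P" for k :: int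
  proof -
    have "to_plane (k * a, k * b) = (1 - real_of_int k) *\<^sub>R 0 + real_of_int k *\<^sub>R to_plane (a, b)"
      by (simp add: to_plane_def)
    then show ?thesis
      unfolding P_def affine_hull_2 by (metis (mono_tags, lifting) diff_add_cancel mem_Collect_eq)
  qed
  have "plane_line P"
    unfolding plane_line_def P_def using ne
    by (simp add: aff_dim_affine_hull aff_dim_2)
  moreover have "to_plane (0, 0) \<in> P" "to_plane (a, b) \<in> P"
    using mult[of 0] mult[of 1] by simp_all
  ultimately have "lattice_line L"
    unfolding lattice_line_def L_def using assms(1) by metis
  then have "torus_line n (torus_proj n ` L)"
    unfolding torus_line_def by blast
  moreover have "A \<subseteq> torus_proj n ` L"
    using assms(2) mult by (fastforce simp: L_def)
  ultimately show ?thesis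
    unfolding torus_collinear_def by blast
qed

lemma torus_proj_id:
  assumes "x \<in> torus n"
  shows "torus_proj n x = x"
  using assms by (auto simp: torus_def torus_proj_def)

lemma torus_proj_cong:
  assumes "[a = c] (mod int n)" and "[b = d] (mod int n)"
  shows "torus_proj n (a, b) = torus_proj n (c, d)"
  using assms by (simp add: torus_proj_def cong_def)

definition direction_set :: "nat \<Rightarrow> nat \<Rightarrow> (int \<times> int) set" where
  "direction_set p q =
     insert (0, 0) (insert (0, int q) ((\<lambda>j. (int q, int q * j)) ` {0..<int p}))"

lemma card_direction_set_le: "card (direction_set p q) \<le> p + 2"
proof -
  have "card ((\<lambda>j. (int q, int q * j)) ` {0..<int p}) \<le> p"
    using card_image_le[of "{0..<int p}"] by fastforce
  then show ?thesis
    unfolding direction_set_def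
    by (intro order.trans[OF card_insert_le_m1]) (auto intro!: card_insert_le_m1)
qed

lemma direction_set_subset_torus:
  assumes "p > 1" and "q > 0"
  shows "direction_set p q \<subseteq> torus (p * q)"
  using assms by (auto simp: direction_set_def torus_def)

text \<open>The origin is excluded so that it and \<open>y\<close> form the pair of distinct points
  that domination requires.\<close>

lemma ex_direction:
  fixes a b :: int
  assumes "prime p" and "q > 0" and "coprime a b"
  shows "\<exists>k. \<exists>y \<in> direction_set p q - {(0, 0)}.
           torus_proj (p * q) (k * a, k * b) = torus_proj (p * q) y"
proof -
  \<comment> \<open>Multiplying both sides and the modulus by \<open>q\<close> preserves a
    congruence, whether or not \<open>p\<close> divides \<open>q\<close>.\<close>
  have scale: "[\<mu> * int q * u = int q * v] (mod int (p * q))"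
    if "[\<mu> * u = v] (mod int p)" for \<mu> u v :: int
  proof -
    have "int p * int q dvd (\<mu> * u - v) * int q"
      using that by (intro mult_dvd_mono) (simp_all add: cong_iff_dvd_diff)
    then show ?thesis
      by (simp add: cong_iff_dvd_diff algebra_simps)
  qed
  have p: "prime (int p)" using assms(1) by simp
  have inv: "\<exists>\<mu>. [\<mu> * u = 1] (mod int p)" if "\<not> int p dvd u" for u :: int
    using cong_solve_coprime_int[of u "int p"] prime_imp_coprime[OF p that]
    by (metis coprime_commute mult.commute)
  show ?thesis
  proof (cases "int p dvd a")
    case False
    then obtain \<mu> where \<mu>: "[\<mu> * a = 1] (mod int p)"
      using inv by blast
    \<comment> \<open>Since \<mu> inverts \<open>a\<close> modulo \<open>p\<close>, this is the
      slope \<open>b / a\<close> modulo \<open>p\<close>, reduced into the range of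
      representatives.\<close>
    define j where "j = (\<mu> * b) mod int p"
    have "torus_proj (p * q) (\<mu> * int q * a, \<mu> * int q * b)
            = torus_proj (p * q) (int q, int q * j)"
      using scale[OF \<mu>] scale[of \<mu> b j] by (intro torus_proj_cong) (auto simp: j_def cong_def)
    moreover have "(int q, int q * j) \<in> direction_set p q - {(0, 0)}"
      using assms(2) prime_gt_0_int[OF p] by (auto simp: direction_set_def j_def)
    ultimately show ?thesis by blast
  next
    case True
    \<comment> \<open>By coprimality \<open>p\<close> cannot divide both coordinates, so modulo
      \<open>p\<close> the direction is vertical.\<close>
    then have "\<not> int p dvd b"
      using assms(3) p by (meson coprime_common_divisor not_prime_unit)
    then obtain \<mu> where \<mu>: "[\<mu> * b = 1] (mod int p)"
      using inv by blast
    have "[\<mu> * a = 0] (mod int p)"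
      using True by (simp add: cong_0_iff)
    then have "torus_proj (p * q) (\<mu> * int q * a, \<mu> * int q * b) = torus_proj (p * q) (0, int q)"
      using scale[OF \<mu>] scale[of \<mu> a 0] by (intro torus_proj_cong) auto
    moreover have "(0, int q) \<in> direction_set p q - {(0, 0)}"
      using assms(2) by (auto simp: direction_set_def)
    ultimately show ?thesis by blast
  qed
qed

lemma dominating_set_direction_set:
  assumes "prime p" and "q > 0"
  shows "dominating_set (p * q) (direction_set p q)"
  unfolding dominating_set_def
proof (intro conjI ballI)
  show sub: "direction_set p q \<subseteq> torus (p * q)"
    using assms by (intro direction_set_subset_torus prime_gt_1_nat)
  fix z assume z: "z \<in> torus (p * q)"
  have origin: "(0, 0) \<in> direction_set p q"
    by (simp add: direction_set_def)
  show "dominated (p * q) (direction_set p q) z"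
  proof (cases "z = (0, 0)")
    case True
    then show ?thesis using origin by (simp add: dominated_def)
  next
    case False
    obtain c d where cd: "z = (c, d)" by fastforce
    then have "gcd c d \<noteq> 0" using False by simp
    \<comment> \<open>The direction is made primitive; the factor \<open>gcd c d\<close> is the
      multiplier that later recovers \<open>z\<close>.\<close>
    then obtain a b where ab: "c = a * gcd c d" "d = b * gcd c d" "coprime a b"
      using gcd_coprime_exists by blast
    obtain k y where y: "y \<in> direction_set p q" "y \<noteq> (0, 0)"
      and k: "torus_proj (p * q) (k * a, k * b) = torus_proj (p * q) y"
      using ex_direction[OF assms ab(3)] by blast
    have "torus_collinear (p * q) {(0, 0), y, z}"
    proof (rule torus_collinear_multiples)
      show "(a, b) \<noteq> (0, 0)" using ab(3) by auto
      fix x assume "x \<in> {(0, 0), y, z}"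
      then consider "x = (0, 0)" | "x = y" | "x = z" by blast
      then show "\<exists>k. x = torus_proj (p * q) (k * a, k * b)"
      proof cases
        case 1
        then show ?thesis by (intro exI[of _ 0]) (simp add: torus_proj_def)
      next
        case 2
        then show ?thesis using k y(1) sub torus_proj_id by (metis subsetD)
      next
        case 3
        then show ?thesis
          using ab(1,2) cd torus_proj_id[OF z] by (metis mult.commute)
      qed
    qed
    then show ?thesis
      unfolding dominated_def using origin y by metis
  qed
qed

lemma torus_domination_number_le_card:
  assumes "dominating_set n S"
  shows "torus_domination_number n \<le> card S"
  unfolding torus_domination_number_def using assms by (blast intro: Least_le)

theorem theorem9:
  fixes n p q :: nat
  assumes "prime p" and "q > 0" and "n = p * q"
  shows "if gcd p q = 1 then torus_domination_number n \<le> 2 * p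
         else torus_domination_number n \<le> 2 * (p + 1)"
proof -
  have "torus_domination_number n \<le> p + 2"
    using torus_domination_number_le_card[OF dominating_set_direction_set[OF assms(1,2)]]
      card_direction_set_le[of p q] assms(3) by simp
  moreover have "p \<ge> 2"
    using assms(1) by (rule prime_ge_2_nat)
  ultimately show ?thesis by simp
qed

end
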